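(* Let $q$ be a complex number with $|q|<1$ and let $R(q)=\dfrac{(q,q^4;q^5)_\infty}{(q^2,q^3;q^5)_\infty}$. Then \begin{align*} R(q)R(q^2)^2 &=\frac{(q^5,q^5,q^{25},q^{25},q^{25},q^{25},q^{45},q^{45};q^{50})_\infty}{(q^{10},q^{10},q^{10},q^{20},q^{30},q^{40},q^{40},q^{40};q^{50})_\infty} -q\,\frac{(q^5,q^5,q^{15},q^{25},q^{25},q^{35},q^{45},q^{45};q^{50})_\infty}{(q^{10},q^{10},q^{10},q^{20},q^{30},q^{40},q^{40},q^{40};q^{50})_\infty}\\ &\quad-q^2\,\frac{(q^5,q^{15},q^{15},q^{25},q^{25},q^{35},q^{35},q^{45};q^{50})_\infty}{(q^{10},q^{20},q^{20},q^{20},q^{30},q^{30},q^{30},q^{40};q^{50})_\infty} +2q^3\,\frac{(q^5,q^5,q^{15},q^{25},q^{25},q^{35},q^{45},q^{45};q^{50})_\infty}{(q^{10},q^{10},q^{20},q^{20},q^{30},q^{30},q^{40},q^{40};q^{50})_\infty}\\ &\quad+q^9\,\frac{(q^5,q^5,q^5,q^{15},q^{35},q^{45},q^{45},q^{45};q^{50})_\infty}{(q^{10},q^{20},q^{20},q^{20},q^{30},q^{30},q^{30},q^{40};q^{50})_\infty} \end{align*} and \begin{align*} \frac{1}{R(q)R(q^2)^2} &=\frac{(q^{15},q^{15},q^{25},q^{25},q^{25},q^{25},q^{35},q^{35};q^{50})_\infty}{(q^{10},q^{20},q^{20},q^{20},q^{30},q^{30},q^{30},q^{40};q^{50})_\infty}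 +q\,\frac{(q^5,q^{15},q^{15},q^{15},q^{35},q^{35},q^{35},q^{45};q^{50})_\infty}{(q^{10},q^{10},q^{10},q^{20},q^{30},q^{40},q^{40},q^{40};q^{50})_\infty}\\ &\quad+2q^2\,\frac{(q^5,q^{15},q^{15},q^{25},q^{25},q^{35},q^{35},q^{45};q^{50})_\infty}{(q^{10},q^{10},q^{20},q^{20},q^{30},q^{30},q^{40},q^{40};q^{50})_\infty} +q^3\,\frac{(q^5,q^5,q^{15},q^{25},q^{25},q^{35},q^{45},q^{45};q^{50})_\infty}{(q^{10},q^{10},q^{10},q^{20},q^{30},q^{40},q^{40},q^{40};q^{50})_\infty}\\ &\quad+q^4\,\frac{(q^5,q^{15},q^{15},q^{25},q^{25},q^{35},q^{35},q^{45};q^{50})_\infty}{(q^{10},q^{20},q^{20},q^{20},q^{30},q^{30},q^{30},q^{40};q^{50})_\infty}. \end{align*}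
   Context: For $|q|<1$: $(A;q)_\infty=\prod_{k\ge0}(1-Aq^k)$ and $(A_1,\dots,A_n;q)_\infty=(A_1;q)_\infty\cdots(A_n;q)_\infty$ (repeated entries are repeated factors). $R(q)$ is the Rogers--Ramanujan continued fraction $\frac{1}{1+}\frac{q}{1+}\frac{q^2}{1+}\cdots$ without the factor $q^{1/5}$, which equals the stated product. *)

theory Defs
  imports "HOL-Analysis.Infinite_Products"
begin

text \<open>The library's infinite product allows finitely many factors to vanish (its value is then 0);
  for |q| < 1 the product below converges for every A.\<close>

definition qpoch :: "complex \<Rightarrow> complex \<Rightarrow> complex" where
  "qpoch A q = (\<Prod>k. 1 - A * q ^ k)"

text \<open>The list keeps multiplicities, so repeated entries are repeated factors.\<close>

definition qpochs :: "complex list \<Rightarrow> complex \<Rightarrow> complex" where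
  "qpochs As q = prod_list (map (\<lambda>A. qpoch A q) As)"

text \<open>Product form of the Rogers--Ramanujan continued fraction 1/(1+) q/(1+) q^2/(1+) ...,
  normalised without the factor q^(1/5).\<close>

definition RR :: "complex \<Rightarrow> complex" where
  "RR q = qpochs [q, q ^ 4] (q ^ 5) / qpochs [q ^ 2, q ^ 3] (q ^ 5)"

end

theory Submission
  imports Defs "HOL-Analysis.Infinite_Sum" "HOL-Analysis.Uniform_Limit"
    "HOL-Computational_Algebra.Polynomial" "HOL-Library.Nat_Bijection"
begin

text \<open>
  Write \<open>[z; p]\<close> for the theta function \<open>(z, p/z; p)\<^sub>\<infinity>\<close> and \<open>P\<^sub>i = [q^i; q^10]\<close>. Then
  \<open>R(q) R(q^2)^2 = (P\<^sub>8 / P\<^sub>3) (P\<^sub>9 / P\<^sub>4)\<close> and its reciprocal is \<open>(P\<^sub>6 / P\<^sub>1) (P\<^sub>7 / P\<^sub>2)\<close>.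
  Each quotient \<open>P\<^sub>5\<^sub>+\<^sub>t / P\<^sub>t\<close> is, up to a factor depending only on \<open>q^5\<close>, a bilateral series
  \<open>\<Sum> a^n / (1 - z p^n)\<close> with \<open>a = q^5\<close>, \<open>p = q^10\<close>, \<open>z = q^t\<close> (Kronecker). Expanding
  \<open>1 / (1 - Z) = (1 + Z + Z^2 + Z^3 + Z^4) / (1 - Z^5)\<close> splits this series by residues modulo 5 into
  series of the same kind with \<open>q^50\<close> in place of \<open>q^10\<close>. In a product of two such dissections the
  theta quotients of each residue class combine by three instances of the three-term relation for
  theta functions.
\<close>

section \<open>Infinite products as limits of finite ones\<close>

lemma qpoch_convergent:
  fixes A q :: complex
  assumes "norm q < 1"
  shows "convergent_prod (\<lambda>k. 1 - A * q ^ k)"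
proof -
  have "summable (\<lambda>k. norm (A * q ^ k))"
    unfolding norm_mult norm_power using assms by (intro summable_mult summable_geometric) simp
  then have "abs_convergent_prod (\<lambda>k. 1 - A * q ^ k)"
    by (intro summable_imp_abs_convergent_prod) simp
  then show ?thesis
    by (rule abs_convergent_prod_imp_convergent_prod)
qed

definition qpoch_fin :: "complex \<Rightarrow> complex \<Rightarrow> nat \<Rightarrow> complex" where
  "qpoch_fin A q n = (\<Prod>k<n. 1 - A * q ^ k)"

lemma qpoch_fin_LIMSEQ:
  assumes "norm q < 1"
  shows "qpoch_fin A q \<longlonglongrightarrow> qpoch A q"
proof -
  have "(\<lambda>n. \<Prod>k\<le>n. 1 - A * q ^ k) \<longlonglongrightarrow> qpoch A q"
    using convergent_prod_LIMSEQ[OF qpoch_convergent[OF assms]] by (simp add: qpoch_def)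
  then have "(\<lambda>n. qpoch_fin A q (Suc n)) \<longlonglongrightarrow> qpoch A q"
    by (simp add: qpoch_fin_def lessThan_Suc_atMost)
  then show ?thesis
    by (simp only: filterlim_sequentially_Suc)
qed

lemma qpoch_nonzero:
  assumes "norm q < 1" "\<And>k. A * q ^ k \<noteq> 1"
  shows "qpoch A q \<noteq> 0"
  unfolding qpoch_def using assms(2)
  by (intro prodinf_nonzero qpoch_convergent[OF assms(1)]) (metis eq_iff_diff_eq_0)

lemma qpoch_shift:
  assumes "norm q < 1"
  shows "qpoch A q = (1 - A) * qpoch (A * q) q"
proof (rule LIMSEQ_unique)
  show "(\<lambda>n. qpoch_fin A q (Suc n)) \<longlonglongrightarrow> qpoch A q"
    using qpoch_fin_LIMSEQ[OF assms] by (simp only: filterlim_sequentially_Suc)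
  have "qpoch_fin A q (Suc n) = (1 - A) * qpoch_fin (A * q) q n" for n
    unfolding qpoch_fin_def prod.lessThan_Suc_shift by (simp add: mult_ac)
  then show "(\<lambda>n. qpoch_fin A q (Suc n)) \<longlonglongrightarrow> (1 - A) * qpoch (A * q) q"
    by (simp add: qpoch_fin_LIMSEQ[OF assms] tendsto_mult_left)
qed

text \<open>Factors are sorted by the residue of their exponent modulo \<open>m\<close>: the first
  \<open>n * m\<close> of them form \<open>n\<close> blocks of length \<open>m\<close>, and
  exchanging the two finite products collects one residue at a time.\<close>

lemma qpoch_dissect:
  assumes "norm q < 1" "m > 0"
  shows "qpoch A q = (\<Prod>r<m. qpoch (A * q ^ r) (q ^ m))"
proof (rule LIMSEQ_unique)
  have qm: "norm (q ^ m) < 1"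
    using assms by (simp add: norm_power power_less_one_iff)
  show "(\<lambda>n. qpoch_fin A q (n * m)) \<longlonglongrightarrow> qpoch A q"
    using assms
    by (intro filterlim_compose[OF qpoch_fin_LIMSEQ[OF assms(1)]] mult_nat_right_at_top)
  have "qpoch_fin A q (n * m) = (\<Prod>r<m. qpoch_fin (A * q ^ r) (q ^ m) n)" for n
  proof -
    have "qpoch_fin A q (n * m) = (\<Prod>i<n. \<Prod>k\<in>{i * m..<i * m + m}. 1 - A * q ^ k)"
      unfolding qpoch_fin_def by (rule prod.nat_group[symmetric])
    also have "\<dots> = (\<Prod>i<n. \<Prod>r<m. 1 - A * q ^ r * (q ^ m) ^ i)"
    proof (rule prod.cong[OF refl])
      fix i
      show "(\<Prod>k\<in>{i * m..<i * m + m}. 1 - A * q ^ k) = (\<Prod>r<m. 1 - A * q ^ r * (q ^ m) ^ i)"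
        using prod.shift_bounds_nat_ivl[of "\<lambda>k. 1 - A * q ^ k" 0 "i * m" m]
        by (simp add: power_add power_mult[symmetric] ac_simps lessThan_atLeast0)
    qed
    also have "\<dots> = (\<Prod>r<m. qpoch_fin (A * q ^ r) (q ^ m) n)"
      unfolding qpoch_fin_def by (rule prod.swap)
    finally show ?thesis .
  qed
  then show "(\<lambda>n. qpoch_fin A q (n * m)) \<longlonglongrightarrow> (\<Prod>r<m. qpoch (A * q ^ r) (q ^ m))"
    by (simp add: qpoch_fin_LIMSEQ[OF qm] tendsto_prod)
qed

section \<open>Partial fractions and finite forms of Kronecker's identity\<close>

text \<open>Lagrange interpolation: after clearing denominators both sides are polynomials in
  \<open>z\<close> of degree below \<open>card I\<close> that agree at the \<open>card I\<close>
  distinct points \<open>1 / w i\<close>.\<close>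

lemma partial_fractions:
  fixes A :: "complex poly" and w :: "'i \<Rightarrow> complex"
  assumes "finite I" "inj_on w I" "\<And>i. i \<in> I \<Longrightarrow> w i \<noteq> 0" "degree A < card I"
    and z: "\<And>i. i \<in> I \<Longrightarrow> z * w i \<noteq> 1"
  shows "poly A z / (\<Prod>i\<in>I. 1 - z * w i) =
         (\<Sum>i\<in>I. poly A (1 / w i) / (\<Prod>l\<in>I - {i}. 1 - w l / w i) / (1 - z * w i))"
proof -
  define c where "c = (\<lambda>i. poly A (1 / w i) / (\<Prod>l\<in>I - {i}. 1 - w l / w i))"
  define P where "P = (\<Sum>i\<in>I. smult (c i) (\<Prod>l\<in>I - {i}. [:1, - w l:]))"
  have poly_P: "poly P x = (\<Sum>i\<in>I. c i * (\<Prod>l\<in>I - {i}. 1 - x * w l))" for x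
    unfolding P_def by (simp add: poly_sum poly_prod)
  have card: "card ((\<lambda>i. 1 / w i) ` I) = card I"
    using assms by (intro card_image) (auto simp: inj_on_def divide_simps)
  have "degree (smult (c i) (\<Prod>l\<in>I - {i}. [:1, - w l:])) < card I" if "i \<in> I" for i
  proof -
    have "degree (\<Prod>l\<in>I - {i}. [:1, - w l:]) \<le> (\<Sum>l\<in>I - {i}. degree [:1, - w l:])"
      by (rule degree_prod_sum_le[unfolded o_def]) (use assms(1) in auto)
    also have "\<dots> \<le> (\<Sum>l\<in>I - {i}. 1)"
      by (intro sum_mono) simp
    also have "\<dots> < card I"
      using that assms(1) card_Diff1_less by fastforce
    finally show ?thesis
      using degree_smult_le le_less_trans by blast
  qed
  then have deg: "degree P < card I"
    unfolding P_def using assms(4) by (intro degree_sum_less) auto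
  have "A = P"
  proof (rule poly_eqI_degree[where A = "(\<lambda>i. 1 / w i) ` I"])
    fix x assume "x \<in> (\<lambda>i. 1 / w i) ` I"
    then obtain i where i: "i \<in> I" "x = 1 / w i" by auto
    have "poly P x = (\<Sum>j\<in>I. if j = i then poly A x else 0)"
      unfolding poly_P
    proof (rule sum.cong[OF refl])
      fix j assume j: "j \<in> I"
      show "c j * (\<Prod>l\<in>I - {j}. 1 - x * w l) = (if j = i then poly A x else 0)"
      proof (cases "j = i")
        case True
        have "w l \<noteq> w i" if "l \<in> I - {i}" for l
          using that i(1) assms(2) by (auto simp: inj_on_def)
        then have "(\<Prod>l\<in>I - {i}. 1 - w l / w i) \<noteq> 0"
          using assms i(1) by (auto simp: prod_zero_iff)
        then show ?thesis
          using True i by (simp add: c_def)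
      next
        case False
        then have "(\<Prod>l\<in>I - {j}. 1 - x * w l) = 0"
          using i assms by (intro prod_zero) (auto intro!: bexI[of _ i])
        then show ?thesis using False by simp
      qed
    qed
    then show "poly A x = poly P x"
      using i assms(1) by simp
  qed (use card deg assms in auto)
  have "poly A z / (\<Prod>i\<in>I. 1 - z * w i) = (\<Sum>i\<in>I. c i * (\<Prod>l\<in>I - {i}. 1 - z * w l) / (\<Prod>i\<in>I. 1 - z * w i))"
    unfolding \<open>A = P\<close> poly_P by (simp add: sum_divide_distrib)
  also have "\<dots> = (\<Sum>i\<in>I. c i / (1 - z * w i))"
  proof (rule sum.cong[OF refl])
    fix i assume i: "i \<in> I"
    have "(\<Prod>l\<in>I - {i}. 1 - z * w l) \<noteq> 0"
      using assms by (auto simp: prod_zero_iff)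
    then show "c i * (\<Prod>l\<in>I - {i}. 1 - z * w l) / (\<Prod>i\<in>I. 1 - z * w i) = c i / (1 - z * w i)"
      using prod.remove[OF assms(1) i, of "\<lambda>i. 1 - z * w i"] by simp
  qed
  finally show ?thesis by (simp add: c_def)
qed

lemma prod_lessThan_add:
  fixes f :: "nat \<Rightarrow> 'a::comm_monoid_mult"
  shows "(\<Prod>i<m + n. f i) = (\<Prod>i<m. f i) * (\<Prod>i<n. f (m + i))"
  by (induction n) (simp_all add: mult_ac)

text \<open>Reading the products backwards, \<open>l = n - Suc r\<close>, turns negative powers of
  \<open>p\<close> into the ascending powers of \<open>qpoch_fin\<close>; each quotient of factors
  leaves one \<open>a\<close> behind.\<close>

lemma reflected_ratio:
  assumes "p \<noteq> 0" "z \<noteq> 0" "a \<noteq> 0"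
  shows "(\<Prod>l<n. 1 - a * z * p ^ l / p ^ n) / (\<Prod>l<n. 1 - z * p ^ l / p ^ n) =
         a ^ n * qpoch_fin (p / (a * z)) p n / qpoch_fin (p / z) p n"
proof -
  have "(\<Prod>l<n. 1 - a * z * p ^ l / p ^ n) / (\<Prod>l<n. 1 - z * p ^ l / p ^ n) =
        (\<Prod>l<n. (1 - a * z * p ^ l / p ^ n) / (1 - z * p ^ l / p ^ n))"
    by (simp add: prod_dividef)
  also have "\<dots> = (\<Prod>r<n. (1 - a * z * p ^ (n - Suc r) / p ^ n) / (1 - z * p ^ (n - Suc r) / p ^ n))"
    by (rule prod.nat_diff_reindex[symmetric])
  also have "\<dots> = (\<Prod>r<n. a * (1 - p / (a * z) * p ^ r) / (1 - p / z * p ^ r))"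
  proof (rule prod.cong[OF refl])
    fix r assume "r \<in> {..<n}"
    then have n: "p ^ n = p ^ (n - Suc r) * (p * p ^ r)"
      by (simp flip: power_Suc power_add)
    have e: "p ^ (n - Suc r) / p ^ n = 1 / (p * p ^ r)"
      using assms unfolding n by simp
    have "(1 - a * z * p ^ (n - Suc r) / p ^ n) / (1 - z * p ^ (n - Suc r) / p ^ n) =
          (1 - a * z / (p * p ^ r)) / (1 - z / (p * p ^ r))"
      unfolding times_divide_eq_right[symmetric] e by simp
    also have "\<dots> = (p * p ^ r - a * z) / (p * p ^ r - z)"
      using assms by (simp add: diff_divide_eq_iff divide_simps)
    also have "\<dots> = a * (1 - p / (a * z) * p ^ r) / (1 - p / z * p ^ r)"
    proof -
      have "a * (1 - p / (a * z) * p ^ r) = - (p * p ^ r - a * z) / z"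
        using assms by (simp add: field_simps)
      moreover have "1 - p / z * p ^ r = - (p * p ^ r - z) / z"
        using assms by (simp add: field_simps)
      ultimately show ?thesis using assms(2) by (simp del: minus_diff_eq)
    qed
    finally show "(1 - a * z * p ^ (n - Suc r) / p ^ n) / (1 - z * p ^ (n - Suc r) / p ^ n) =
      a * (1 - p / (a * z) * p ^ r) / (1 - p / z * p ^ r)" .
  qed
  also have "\<dots> = a ^ n * qpoch_fin (p / (a * z)) p n / qpoch_fin (p / z) p n"
    unfolding qpoch_fin_def by (simp add: prod_dividef prod.distrib)
  finally show ?thesis .
qed

text \<open>This is \<open>partial_fractions\<close> with the nodes \<open>p ^ i\<close>: the
  numerator has degree at most \<open>M\<close> and there are \<open>Suc M\<close> nodes.\<close>

lemma finite_kronecker: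
  assumes "p \<noteq> 0" "norm p < 1" "a \<noteq> 0" "\<And>i. i \<le> M \<Longrightarrow> z * p ^ i \<noteq> 1"
  shows "qpoch_fin (a * z) p M / qpoch_fin z p (Suc M) =
    (\<Sum>i\<le>M. a ^ i * qpoch_fin (p / a) p i * qpoch_fin a p (M - i) /
             (qpoch_fin p p i * qpoch_fin p p (M - i)) / (1 - z * p ^ i))"
proof -
  define A where "A = (\<Prod>l<M. [:1, - (a * p ^ l):])"
  have poly_A: "poly A x = (\<Prod>l<M. 1 - a * x * p ^ l)" for x
    unfolding A_def by (simp add: poly_prod mult_ac)
  have "degree A \<le> (\<Sum>l<M. degree [:1, - (a * p ^ l):])"
    unfolding A_def by (rule degree_prod_sum_le[unfolded o_def]) auto
  also have "\<dots> \<le> (\<Sum>l<M. 1)"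
    by (intro sum_mono) simp
  finally have deg: "degree A < card {..M}" by simp
  \<comment> \<open>Since \<open>0 < norm p < 1\<close>, already the norms of the powers
    differ.\<close>
  have inj: "inj_on (\<lambda>i. p ^ i) {..M}"
  proof (rule inj_onI)
    fix i j assume "p ^ i = p ^ j"
    then have "norm p ^ i = norm p ^ j" by (simp flip: norm_power)
    then show "i = j"
      using assms(1,2) by (simp add: power_inject_exp')
  qed
  have "qpoch_fin (a * z) p M / qpoch_fin z p (Suc M) = poly A z / (\<Prod>i\<le>M. 1 - z * p ^ i)"
    by (simp add: poly_A qpoch_fin_def lessThan_Suc_atMost)
  also have "\<dots> = (\<Sum>i\<le>M. poly A (1 / p ^ i) / (\<Prod>l\<in>{..M} - {i}. 1 - p ^ l / p ^ i) / (1 - z * p ^ i))"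
    using assms inj deg by (intro partial_fractions) auto
  also have "\<dots> = (\<Sum>i\<le>M. a ^ i * qpoch_fin (p / a) p i * qpoch_fin a p (M - i) /
             (qpoch_fin p p i * qpoch_fin p p (M - i)) / (1 - z * p ^ i))"
  proof (rule sum.cong[OF refl])
    fix i assume "i \<in> {..M}"
    \<comment> \<open>The coefficient at the node \<open>p ^ i\<close> is cut at
      \<open>l = i\<close>. Factors with smaller \<open>l\<close> carry negative powers of
      \<open>p\<close> and go through \<open>reflected_ratio\<close> with \<open>z = 1\<close>; the
      others form finite products of length \<open>k = M - i\<close>.\<close>
    then obtain k where M: "M = i + k" by (auto simp: le_iff_add)
    have 1: "poly A (1 / p ^ i) = (\<Prod>l<i. 1 - a * p ^ l / p ^ i) * qpoch_fin a p k"
      unfolding poly_A M prod_lessThan_add using assms(1)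
      by (simp add: qpoch_fin_def power_add)
    have set: "{..M} - {i} = {..<i} \<union> (\<lambda>r. Suc (i + r)) ` {..<k}"
    proof -
      have "x \<in> (\<lambda>r. Suc (i + r)) ` {..<k}" if "\<not> x < i" "x \<le> i + k" "x \<noteq> i" for x
        using that by (intro image_eqI[of _ _ "x - Suc i"]) auto
      then show ?thesis unfolding M by auto
    qed
    have 2: "(\<Prod>l\<in>{..M} - {i}. 1 - p ^ l / p ^ i) = (\<Prod>l<i. 1 - p ^ l / p ^ i) * qpoch_fin p p k"
    proof -
      have "(\<Prod>l\<in>(\<lambda>r. Suc (i + r)) ` {..<k}. 1 - p ^ l / p ^ i) = qpoch_fin p p k"
        using assms(1) unfolding qpoch_fin_def
        by (subst prod.reindex) (auto simp: inj_on_def power_add)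
      then show ?thesis
        unfolding set by (subst prod.union_disjoint) auto
    qed
    have "(\<Prod>l<i. 1 - a * p ^ l / p ^ i) / (\<Prod>l<i. 1 - p ^ l / p ^ i) =
          a ^ i * qpoch_fin (p / a) p i / qpoch_fin p p i"
      using reflected_ratio[of p 1 a i] assms by simp
    then have "poly A (1 / p ^ i) / (\<Prod>l\<in>{..M} - {i}. 1 - p ^ l / p ^ i) =
       a ^ i * qpoch_fin (p / a) p i / qpoch_fin p p i * (qpoch_fin a p k / qpoch_fin p p k)"
      unfolding 1 2 by (metis times_divide_times_eq)
    then show "poly A (1 / p ^ i) / (\<Prod>l\<in>{..M} - {i}. 1 - p ^ l / p ^ i) / (1 - z * p ^ i) =
       a ^ i * qpoch_fin (p / a) p i * qpoch_fin a p (M - i) /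
             (qpoch_fin p p i * qpoch_fin p p (M - i)) / (1 - z * p ^ i)"
      by (simp add: M)
  qed
  finally show ?thesis .
qed

section \<open>Theta functions and the bilateral Kronecker series\<close>

definition theta :: "complex \<Rightarrow> complex \<Rightarrow> complex" where
  "theta z p = qpoch z p * qpoch (p / z) p"

definition kronecker_term :: "complex \<Rightarrow> complex \<Rightarrow> complex \<Rightarrow> int \<Rightarrow> complex" where
  "kronecker_term p a z n = a powi n / (1 - z * p powi n)"

lemma qpoch_self_nonzero:
  assumes "norm p < 1"
  shows "qpoch p p \<noteq> 0"
proof (rule qpoch_nonzero[OF assms])
  fix k
  have "norm (p ^ Suc k) < 1"
    using assms by (simp add: norm_power power_less_one_iff del: power_Suc)
  then show "p * p ^ k \<noteq> 1" by force
qed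

text \<open>The zeros of theta are the integral powers of \<open>p\<close>: the hypothesis for
  \<open>n \<ge> 0\<close> keeps the first product from vanishing, the one for \<open>n < 0\<close>
  the second.\<close>

lemma theta_nonzero:
  assumes "norm p < 1" "z \<noteq> 0" "\<And>n. z * p powi n \<noteq> 1"
  shows "theta z p \<noteq> 0"
proof -
  have "z * p ^ k \<noteq> 1" for k
    using assms(3)[of "int k"] by simp
  moreover have "p / z * p ^ k \<noteq> 1" for k
  proof
    assume "p / z * p ^ k = 1"
    then have "p ^ Suc k = z" using assms(2) by (simp add: divide_simps)
    then show False
      using assms(3)[of "- int (Suc k)"] assms(2) by (simp del: of_nat_Suc power_Suc add: power_int_minus)
  qed
  ultimately show ?thesis
    using assms(1) by (simp add: theta_def qpoch_nonzero)
qed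

text \<open>The open annulus between the radii \<open>norm p\<close> and 1 contains no integral
  power of \<open>p\<close>. This yields nearly all non-vanishing conditions below.\<close>

lemma not_power_of_norm:
  fixes a p :: complex
  assumes "norm p < norm a" "norm a < 1"
  shows "a * p powi n \<noteq> 1"
proof (cases "n \<ge> 0")
  case True
  then obtain k where n: "n = int k" using nonneg_int_cases by blast
  have "norm (a * p ^ k) \<le> norm a * 1"
    unfolding norm_mult norm_power using assms by (intro mult_left_mono power_le_one) auto
  then have "norm (a * p ^ k) < 1" using assms by auto
  then show ?thesis unfolding n by force
next
  case False
  then obtain k where n: "n = - int (Suc k)"
    by (cases n rule: int_cases) auto
  show ?thesis
  proof
    assume "a * p powi n = 1"
    then have "a = p ^ Suc k"
      unfolding n power_int_minus power_int_of_nat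
      by (metis divide_eq_1_iff divide_inverse mult_zero_right)
    then have "norm a = norm p * norm p ^ k" by (simp add: norm_mult norm_power)
    also have "\<dots> \<le> norm p * 1"
      using assms by (intro mult_left_mono power_le_one) auto
    finally show False using assms by simp
  qed
qed

text \<open>The terms decay like \<open>norm a ^ n\<close> towards plus infinity and like
  \<open>norm (p / a) ^ n\<close> towards minus infinity; the annulus condition on \<open>a\<close>
  makes both geometric series converge.\<close>

lemma kronecker_abs_summable:
  assumes "p \<noteq> 0" "norm p < norm a" "norm a < 1" "z \<noteq> 0" "\<And>n. z * p powi n \<noteq> 1"
  shows "(\<lambda>n. norm (kronecker_term p a z n)) summable_on UNIV"
proof -
  have a: "a \<noteq> 0" using assms by auto
  have p0: "(\<lambda>n. p ^ n) \<longlonglongrightarrow> 0"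
    using assms by (intro LIMSEQ_power_zero) simp
  \<comment> \<open>A nonzero limit of \<open>d\<close> bounds the reciprocals, so a geometric
    majorant remains.\<close>
  have aux: "(\<lambda>n. norm (b ^ n / d n)) summable_on UNIV"
    if b: "norm b < 1" and d: "d \<longlonglongrightarrow> e" "e \<noteq> 0" for b e :: complex and d
  proof -
    have "convergent (\<lambda>n. inverse (d n))"
      using tendsto_inverse[OF d] by (auto simp: convergent_def)
    then obtain K where K: "\<And>n. norm (inverse (d n)) \<le> K"
      using BseqD[OF convergent_imp_Bseq] by blast
    have "summable (\<lambda>n. norm b ^ n * K)"
      using b by (intro summable_mult2) simp
    moreover have "norm (norm (b ^ n / d n)) \<le> norm b ^ n * K" for n
      using K[of n] by (simp add: divide_inverse norm_mult norm_power mult_left_mono)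
    ultimately have "summable (\<lambda>n. norm (norm (b ^ n / d n)))"
      by (intro summable_comparison_test[of "\<lambda>n. norm (norm (b ^ n / d n))"]) auto
    then show ?thesis by (rule norm_summable_imp_summable_on)
  qed
  have "(\<lambda>n. norm (kronecker_term p a z n)) summable_on range int"
  proof -
    have "(\<lambda>n. 1 - z * p ^ n) \<longlonglongrightarrow> 1 - z * 0"
      by (intro tendsto_intros p0)
    then have "(\<lambda>n. norm (a ^ n / (1 - z * p ^ n))) summable_on UNIV"
      using assms by (intro aux[where e = 1]) auto
    then show ?thesis
      by (subst summable_on_reindex) (auto simp: o_def kronecker_term_def)
  qed
  moreover have "(\<lambda>n. norm (kronecker_term p a z n)) summable_on range (\<lambda>k. - int k)"
  proof -
    have "kronecker_term p a z (- int k) = (p / a) ^ k / (p ^ k - z)" for k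
      using assms(1) a by (simp add: kronecker_term_def power_int_minus field_simps)
    moreover have "(\<lambda>k. p ^ k - z) \<longlonglongrightarrow> 0 - z"
      by (intro tendsto_intros p0)
    then have "(\<lambda>k. norm ((p / a) ^ k / (p ^ k - z))) summable_on UNIV"
      using assms a by (intro aux[where e = "- z"]) (auto simp: norm_divide)
    ultimately show ?thesis
      by (subst summable_on_reindex) (auto simp: o_def inj_on_def)
  qed
  moreover have U: "UNIV = range int \<union> range (\<lambda>k. - int k)"
  proof -
    have "n \<in> range int \<union> range (\<lambda>k. - int k)" for n
      by (cases n rule: int_cases2) auto
    then show ?thesis by blast
  qed
  ultimately show ?thesis
    by (subst U) (rule summable_on_union)
qed

lemma qpoch_fin_bounded:
  assumes "norm p < 1"
  obtains K where "\<And>n. norm (qpoch_fin A p n) \<le> K"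
  using BseqD[OF convergent_imp_Bseq[OF convergentI[OF qpoch_fin_LIMSEQ[OF assms, of A]]]] by blast

text \<open>\<open>finite_kronecker\<close> with \<open>M = 2 * N\<close> and
  \<open>z / p ^ N\<close> in place of \<open>z\<close> centres the summation range at 0. The first
  \<open>N\<close> factors of each product then have negative powers of \<open>p\<close>, which
  \<open>reflected_ratio\<close> turns over; the factor \<open>a ^ N\<close> occurs on both sides
  and is cancelled.\<close>

lemma symmetric_finite_kronecker:
  assumes "p \<noteq> 0" "norm p < 1" "a \<noteq> 0" "z \<noteq> 0" "\<And>n. z * p powi n \<noteq> 1"
  shows "qpoch_fin (p / (a * z)) p N * qpoch_fin (a * z) p N /
           (qpoch_fin (p / z) p N * qpoch_fin z p (Suc N)) =
    (\<Sum>k\<in>{-int N..int N}. qpoch_fin (p / a) p (nat (int N + k)) * qpoch_fin a p (nat (int N - k)) /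
       (qpoch_fin p p (nat (int N + k)) * qpoch_fin p p (nat (int N - k))) * kronecker_term p a z k)"
    (is "?L = ?R")
proof -
  have w: "z / p ^ N * p ^ i = z * p powi (int i - int N)" for i
    using assms(1) by (simp add: power_int_diff)
  have nz: "z / p ^ N * p ^ i \<noteq> 1" for i
    unfolding w by (rule assms(5))
  have split: "qpoch_fin (b / p ^ N) p (N + n) = (\<Prod>l<N. 1 - b * p ^ l / p ^ N) * qpoch_fin b p n" for b n
    using assms(1) unfolding qpoch_fin_def prod_lessThan_add by (simp add: power_add)
  define C where "C = (\<lambda>k. qpoch_fin (p / a) p (nat (int N + k)) * qpoch_fin a p (nat (int N - k)) /
       (qpoch_fin p p (nat (int N + k)) * qpoch_fin p p (nat (int N - k))))"
  have "a ^ N * ?L = (\<Prod>l<N. 1 - a * z * p ^ l / p ^ N) / (\<Prod>l<N. 1 - z * p ^ l / p ^ N) *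
        (qpoch_fin (a * z) p N / qpoch_fin z p (Suc N))"
    using assms by (subst reflected_ratio) auto
  also have "\<dots> = qpoch_fin (a * z / p ^ N) p (N + N) / qpoch_fin (z / p ^ N) p (N + Suc N)"
    unfolding split by simp
  also have "\<dots> = qpoch_fin (a * (z / p ^ N)) p (N + N) / qpoch_fin (z / p ^ N) p (Suc (N + N))"
    by simp
  also have "\<dots> = (\<Sum>i\<le>N + N. a ^ i * qpoch_fin (p / a) p i * qpoch_fin a p (N + N - i) /
             (qpoch_fin p p i * qpoch_fin p p (N + N - i)) / (1 - z / p ^ N * p ^ i))"
    by (intro finite_kronecker assms nz)
  also have "\<dots> = (\<Sum>k\<in>{-int N..int N}. a ^ N * (C k * kronecker_term p a z k))"
  proof (rule sum.reindex_bij_witness[of _ "\<lambda>k. nat (k + int N)" "\<lambda>i. int i - int N"])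
    fix i assume i: "i \<in> {..N + N}"
    have "a ^ i = a ^ N * a powi (int i - int N)"
      using assms(3) by (simp add: power_int_diff)
    moreover have "nat (int N - (int i - int N)) = N + N - i"
      using i by auto
    ultimately show "a ^ N * (C (int i - int N) * kronecker_term p a z (int i - int N)) =
      a ^ i * qpoch_fin (p / a) p i * qpoch_fin a p (N + N - i) /
             (qpoch_fin p p i * qpoch_fin p p (N + N - i)) / (1 - z / p ^ N * p ^ i)"
      unfolding w by (simp add: C_def kronecker_term_def)
  qed auto
  also have "\<dots> = a ^ N * ?R"
    by (simp add: sum_distrib_left C_def)
  finally have "a ^ N * ?L = a ^ N * ?R" .
  moreover have "a ^ N \<noteq> 0" using assms(3) by simp
  ultimately show ?thesis
    by (simp only: mult_cancel_left) simp
qed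

text \<open>Kronecker's identity is the limit of a partial fraction expansion of a finite product.\<close>

theorem kronecker:
  assumes "p \<noteq> 0" "norm p < norm a" "norm a < 1" "z \<noteq> 0" "\<And>n. z * p powi n \<noteq> 1"
  shows "(kronecker_term p a z has_sum
           (qpoch p p) ^ 2 * theta (a * z) p / (theta a p * theta z p)) UNIV"
proof -
  have p: "norm p < 1" and a: "a \<noteq> 0" using assms by auto
  define C where "C = (\<lambda>N k. qpoch_fin (p / a) p (nat (int N + k)) * qpoch_fin a p (nat (int N - k)) /
       (qpoch_fin p p (nat (int N + k)) * qpoch_fin p p (nat (int N - k))))"
  \<comment> \<open>To apply Tannery's theorem to a series over the naturals, the integers are
    enumerated by \<open>int_decode\<close> and the finite sum is extended by zero. The limit of the
    weights \<open>C N k\<close> for fixed \<open>k\<close> is \<open>L\<close>.\<close>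
  define f where "f = (\<lambda>j N. if int_decode j \<in> {-int N..int N}
                         then C N (int_decode j) * kronecker_term p a z (int_decode j) else 0)"
  define L where "L = theta a p / qpoch p p ^ 2"
  have J: "qpoch p p \<noteq> 0" by (rule qpoch_self_nonzero[OF p])
  have th_a: "theta a p \<noteq> 0"
    using assms a not_power_of_norm by (intro theta_nonzero[OF p]) auto
  have th_z: "theta z p \<noteq> 0"
    using assms by (intro theta_nonzero[OF p]) auto
  obtain s where s: "(kronecker_term p a z has_sum s) UNIV"
    using abs_summable_summable[OF kronecker_abs_summable[OF assms]] by (auto simp: summable_on_def)
  have bij: "bij_betw int_decode UNIV UNIV"
    by (rule bij_int_decode)
  have s': "(\<lambda>j. kronecker_term p a z (int_decode j)) sums s"
    using s by (intro has_sum_imp_sums) (simp add: has_sum_reindex_bij_betw[OF bij, of "kronecker_term p a z"])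
  have abs: "summable (\<lambda>j. norm (kronecker_term p a z (int_decode j)))"
    using kronecker_abs_summable[OF assms]
    by (intro summable_on_imp_summable)
      (simp add: summable_on_reindex_bij_betw[OF bij, of "\<lambda>n. norm (kronecker_term p a z n)"])
  have lim_shift: "(\<lambda>N. qpoch_fin A p (nat (int N + k))) \<longlonglongrightarrow> qpoch A p" for A k
  proof (rule filterlim_compose[OF qpoch_fin_LIMSEQ[OF p]])
    show "filterlim (\<lambda>N. nat (int N + k)) at_top sequentially"
      unfolding filterlim_at_top
    proof
      fix Z
      show "\<forall>\<^sub>F N in sequentially. Z \<le> nat (int N + k)"
        using eventually_ge_at_top[of "Z + nat \<bar>k\<bar>"] by eventually_elim linarith
    qed
  qed
  have lim_C: "(\<lambda>N. C N k) \<longlonglongrightarrow> L" for k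
  proof -
    have "(\<lambda>N. C N k) \<longlonglongrightarrow> qpoch (p / a) p * qpoch a p / (qpoch p p * qpoch p p)"
      unfolding C_def using lim_shift[of _ k] lim_shift[of _ "-k"] J by (intro tendsto_intros) auto
    then show ?thesis by (simp add: L_def theta_def power2_eq_square mult_ac)
  qed
  obtain K1 where K1: "\<And>n. norm (qpoch_fin (p / a) p n) \<le> K1"
    using qpoch_fin_bounded[OF p] by blast
  obtain K2 where K2: "\<And>n. norm (qpoch_fin a p n) \<le> K2"
    using qpoch_fin_bounded[OF p] by blast
  have "convergent (\<lambda>n. inverse (qpoch_fin p p n))"
    using tendsto_inverse[OF qpoch_fin_LIMSEQ[OF p] J] by (auto simp: convergent_def)
  then obtain K3 where K3: "\<And>n. norm (inverse (qpoch_fin p p n)) \<le> K3"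
    using BseqD[OF convergent_imp_Bseq] by blast
  \<comment> \<open>The bound is uniform in \<open>N\<close> and \<open>k\<close>, so a constant
    multiple of the absolutely convergent Kronecker series is a majorant.\<close>
  have C_bound: "norm (C N k) \<le> K1 * K2 * (K3 * K3)" for N k
    unfolding C_def divide_inverse inverse_mult_distrib norm_mult
    by (intro mult_mono K1[unfolded divide_inverse] K2 K3 mult_nonneg_nonneg order_trans[OF norm_ge_zero K1[unfolded divide_inverse]]
        order_trans[OF norm_ge_zero K2] order_trans[OF norm_ge_zero K3] norm_ge_zero)
  have "(\<lambda>N. \<Sum>j. f j N) \<longlonglongrightarrow> (\<Sum>j. L * kronecker_term p a z (int_decode j))"
  proof -
    have "(\<lambda>N. f j N) \<longlonglongrightarrow> L * kronecker_term p a z (int_decode j)" for j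
    proof (rule Lim_transform_eventually)
      show "(\<lambda>N. C N (int_decode j) * kronecker_term p a z (int_decode j)) \<longlonglongrightarrow>
              L * kronecker_term p a z (int_decode j)"
        by (intro tendsto_intros lim_C)
      show "\<forall>\<^sub>F N in sequentially. C N (int_decode j) * kronecker_term p a z (int_decode j) = f j N"
        using eventually_ge_at_top[of "nat \<bar>int_decode j\<bar>"]
        by eventually_elim (auto simp: f_def)
    qed
    moreover have "norm (f j N) \<le> K1 * K2 * (K3 * K3) * norm (kronecker_term p a z (int_decode j))" for j N
      using C_bound order_trans[OF norm_ge_zero C_bound]
      by (auto simp: f_def norm_mult intro!: mult_right_mono)
    ultimately show ?thesis
      using tannerys_theorem[where a = f and F = sequentially and b = "\<lambda>j. L * kronecker_term p a z (int_decode j)"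
          and M = "\<lambda>j. K1 * K2 * (K3 * K3) * norm (kronecker_term p a z (int_decode j))"]
        summable_mult[OF abs] by (simp add: always_eventually)
  qed
  also have "(\<Sum>j. L * kronecker_term p a z (int_decode j)) = L * s"
    using sums_mult[OF s'] by (rule sums_unique[symmetric])
  also have "(\<lambda>N. \<Sum>j. f j N) = (\<lambda>N. qpoch_fin (p / (a * z)) p N * qpoch_fin (a * z) p N /
           (qpoch_fin (p / z) p N * qpoch_fin z p (Suc N)))"
  proof
    fix N
    have "(\<Sum>j. f j N) = (\<Sum>j\<in>int_encode ` {-int N..int N}. f j N)"
    proof (rule suminf_finite)
      fix j assume "j \<notin> int_encode ` {-int N..int N}"
      then have "int_decode j \<notin> {-int N..int N}"
        by (metis imageI int_decode_inverse)
      then show "f j N = 0" unfolding f_def by (rule if_not_P)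
    qed simp
    also have "\<dots> = (\<Sum>k\<in>{-int N..int N}. C N k * kronecker_term p a z k)"
      by (subst sum.reindex) (auto simp: f_def inj_int_encode)
    also have "\<dots> = qpoch_fin (p / (a * z)) p N * qpoch_fin (a * z) p N /
           (qpoch_fin (p / z) p N * qpoch_fin z p (Suc N))"
      using symmetric_finite_kronecker[OF assms(1) p a assms(4,5), of N] by (simp add: C_def)
    finally show "(\<Sum>j. f j N) = qpoch_fin (p / (a * z)) p N * qpoch_fin (a * z) p N /
           (qpoch_fin (p / z) p N * qpoch_fin z p (Suc N))" .
  qed
  finally have lim1: "(\<lambda>N. qpoch_fin (p / (a * z)) p N * qpoch_fin (a * z) p N /
           (qpoch_fin (p / z) p N * qpoch_fin z p (Suc N))) \<longlonglongrightarrow> L * s" .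
  have "(\<lambda>N. qpoch_fin z p (Suc N)) \<longlonglongrightarrow> qpoch z p"
    using qpoch_fin_LIMSEQ[OF p] by (simp only: filterlim_sequentially_Suc)
  then have "(\<lambda>N. qpoch_fin (p / (a * z)) p N * qpoch_fin (a * z) p N /
           (qpoch_fin (p / z) p N * qpoch_fin z p (Suc N))) \<longlonglongrightarrow>
        qpoch (p / (a * z)) p * qpoch (a * z) p / (qpoch (p / z) p * qpoch z p)"
    using th_z by (intro tendsto_intros qpoch_fin_LIMSEQ[OF p]) (auto simp: theta_def)
  with lim1 have "L * s = qpoch (p / (a * z)) p * qpoch (a * z) p / (qpoch (p / z) p * qpoch z p)"
    by (rule LIMSEQ_unique)
  then have "L * s = theta (a * z) p / theta z p"
    by (simp add: theta_def mult_ac)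
  moreover have "s = L * s * (qpoch p p ^ 2 / theta a p)"
    using J th_a by (simp add: L_def)
  ultimately have "s = theta (a * z) p / theta z p * (qpoch p p ^ 2 / theta a p)"
    by simp
  then have "s = qpoch p p ^ 2 * theta (a * z) p / (theta a p * theta z p)"
    by (simp add: mult_ac)
  with s show ?thesis by simp
qed

section \<open>Functional equations and the three-term relation\<close>

text \<open>Passing from \<open>z\<close> to \<open>p * z\<close> removes the factor
  \<open>1 - z\<close> from the first product and adds \<open>1 - 1 / z\<close> to the second; their
  ratio is \<open>- 1 / z\<close>.\<close>

lemma theta_shift:
  assumes "norm p < 1" "p \<noteq> 0" "z \<noteq> 0"
  shows "theta (p * z) p = - theta z p / z"
proof -
  have "theta (p * z) p = qpoch (z * p) p * ((1 - 1 / z) * qpoch (1 / z * p) p)"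
    using assms qpoch_shift[OF assms(1), of "1 / z"] by (simp add: theta_def mult.commute)
  also have "\<dots> = - ((1 - z) * qpoch (z * p) p * qpoch (p / z) p) / z"
    using assms(3) by (simp add: field_simps)
  also have "\<dots> = - theta z p / z"
    using qpoch_shift[OF assms(1), of z] by (simp add: theta_def)
  finally show ?thesis .
qed

lemma theta_reflect:
  assumes "p \<noteq> 0"
  shows "theta (p / z) p = theta z p"
  using assms by (simp add: theta_def mult.commute)

lemma theta_inverse:
  assumes "norm p < 1" "p \<noteq> 0" "z \<noteq> 0"
  shows "theta (1 / z) p = - theta z p / z"
  using theta_reflect[OF assms(2), of "p * z"] theta_shift[OF assms] assms(2) by simp

lemma has_sum_finite_sum:
  fixes f :: "'i \<Rightarrow> 'j \<Rightarrow> complex"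
  assumes "\<And>i. i \<in> I \<Longrightarrow> (f i has_sum s i) A"
  shows "((\<lambda>x. \<Sum>i\<in>I. f i x) has_sum (\<Sum>i\<in>I. s i)) A"
  using assms by (induction I rule: infinite_finite_induct) (auto intro: has_sum_add)

lemma has_sum_times:
  fixes f :: "'i \<Rightarrow> complex" and g :: "'j \<Rightarrow> complex"
  assumes "(f has_sum s) A" "(g has_sum t) B"
    and "(\<lambda>x. norm (f x)) summable_on A" "(\<lambda>y. norm (g y)) summable_on B"
  shows "((\<lambda>(x, y). f x * g y) has_sum s * t) (A \<times> B)"
proof (rule has_sum_SigmaI)
  show "((\<lambda>y. case (x, y) of (x, y) \<Rightarrow> f x * g y) has_sum f x * t) B" for x
    using has_sum_cmult_right[OF assms(2)] by simp
  show "((\<lambda>x. f x * t) has_sum s * t) A"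
    using has_sum_cmult_left[OF assms(1)] by simp
  have "(\<lambda>z. norm ((\<lambda>(x, y). f x * g y) z)) summable_on A \<times> B"
    unfolding Infinite_Sum.abs_summable_on_Sigma_iff
    using assms(3,4)
    by (auto simp: norm_mult abs_mult infsum_cmult_right' intro!: summable_on_cmult_right summable_on_cmult_left)
  then show "(\<lambda>(x, y). f x * g y) summable_on A \<times> B"
    by (rule abs_summable_summable)
qed

text \<open>With \<open>u = y * c * p powi m\<close> and \<open>v = y * p powi n\<close> this is the
  identity 1/((1-u)(1-v)) = 1/((1-u)(1-v/u)) + 1/((1-v)(1-u/v)). Since \<open>v / u\<close> depends
  only on \<open>n - m\<close>, both parts of the double sum factor after a change of summation
  variables.\<close>

lemma kronecker_product_split:
  assumes "p \<noteq> 0" "a \<noteq> 0" "b \<noteq> 0" "y \<noteq> 0" "c \<noteq> 0"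
    and "\<And>n. c * p powi n \<noteq> 1" "\<And>n. y * p powi n \<noteq> 1" "\<And>n. y * c * p powi n \<noteq> 1"
  shows "kronecker_term p a (y * c) m * kronecker_term p b y n =
           kronecker_term p (a * b) (y * c) m * kronecker_term p b (1 / c) (n - m) +
           kronecker_term p (a * b) y n * kronecker_term p a c (m - n)"
proof -
  define P where "P = p powi m"
  define k where "k = n - m"
  define K where "K = p powi k"
  have n: "n = m + k" by (simp add: k_def)
  have pn: "p powi n = P * K" and nz: "P \<noteq> 0" "K \<noteq> 0"
    using assms(1) by (simp_all add: n P_def K_def power_int_add)
  have 1: "1 - y * c * P \<noteq> 0" using assms(8)[of m] by (simp add: P_def)
  have 2: "1 - y * (P * K) \<noteq> 0" using assms(7)[of n] by (simp add: pn)
  have 3: "K \<noteq> c" using assms(6)[of "- k"] assms(5) by (auto simp: K_def power_int_minus)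
  have "1 / ((1 - y * c * P) * (1 - y * (P * K))) =
        1 / ((1 - y * c * P) * (1 - K / c)) + 1 / ((1 - y * (P * K)) * (1 - c / K))"
  proof -
    have e: "1 / (1 - K / c) = c / (c - K)" "1 / (1 - c / K) = - K / (c - K)"
      using 3 assms(5) nz by (auto simp: divide_simps algebra_simps)
    have "1 / ((1 - y * c * P) * (1 - K / c)) + 1 / ((1 - y * (P * K)) * (1 - c / K))
        = 1 / (1 - y * c * P) * (1 / (1 - K / c)) + 1 / (1 - y * (P * K)) * (1 / (1 - c / K))"
      by simp
    also have "\<dots> = (c / (1 - y * c * P) - K / (1 - y * (P * K))) / (c - K)"
      unfolding e by (simp add: diff_divide_distrib)
    also have "c / (1 - y * c * P) - K / (1 - y * (P * K)) =
        (c - K) / ((1 - y * c * P) * (1 - y * (P * K)))"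
      using 1 2 by (simp add: diff_frac_eq) (simp add: algebra_simps)
    finally show ?thesis using 3 by simp
  qed
  moreover have "kronecker_term p a (y * c) m * kronecker_term p b y n =
      a powi m * b powi n * (1 / ((1 - y * c * P) * (1 - y * (P * K))))"
    by (simp add: kronecker_term_def pn P_def[symmetric])
  moreover have "kronecker_term p (a * b) (y * c) m * kronecker_term p b (1 / c) (n - m) =
      a powi m * b powi n * (1 / ((1 - y * c * P) * (1 - K / c)))"
    using assms(3) by (simp add: kronecker_term_def power_int_mult_distrib n power_int_add
        P_def[symmetric] K_def[symmetric])
  moreover have "kronecker_term p (a * b) y n * kronecker_term p a c (m - n) =
      a powi m * b powi n * (1 / ((1 - y * (P * K)) * (1 - c / K)))"
  proof -
    have am: "a powi n * a powi (m - n) = a powi m"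
      using assms(2) by (simp flip: power_int_add)
    have pmn: "p powi (m - n) = 1 / K"
      unfolding K_def k_def using power_int_minus[of p "n - m"] by (simp add: divide_inverse)
    have "kronecker_term p (a * b) y n * kronecker_term p a c (m - n) =
      (a powi n * a powi (m - n)) * b powi n * (1 / ((1 - y * (P * K)) * (1 - c / K)))"
      by (simp add: kronecker_term_def power_int_mult_distrib pn pmn)
    then show ?thesis unfolding am .
  qed
  ultimately show ?thesis by (simp add: distrib_left)
qed

text \<open>Clears the denominators in the comparison of Kronecker sums. The capitals stand for
  theta values, \<open>W\<close> for the squared \<open>qpoch p p\<close>, and
  \<open>- C / c\<close> for theta at \<open>1 / c\<close>.\<close>

lemma three_term_algebra:
  fixes A B AB Y C X W c :: complex
  assumes nz: "A \<noteq> 0" "B \<noteq> 0" "AB \<noteq> 0" "Y \<noteq> 0" "C \<noteq> 0" "X \<noteq> 0" "W \<noteq> 0"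
    and eq: "W * n1 / (A * X) * (W * n2 / (B * Y)) =
       W * n3 / (AB * X) * (W * n4 / (B * (- C / c))) + W * n5 / (AB * Y) * (W * n6 / (A * C))"
    and c: "c \<noteq> 0"
  shows "n1 * n2 * AB * C = n5 * n6 * B * X - c * n3 * n4 * A * Y"
proof -
  define D where "D = A * X * B * Y * AB * C / (W * W)"
  have "D * (W * n1 / (A * X) * (W * n2 / (B * Y))) = n1 * n2 * AB * C"
    using nz by (simp add: D_def)
  moreover have "D * (W * n3 / (AB * X) * (W * n4 / (B * (- C / c)))) = - (c * n3 * n4 * A * Y)"
    using nz c by (simp add: D_def)
  moreover have "D * (W * n5 / (AB * Y) * (W * n6 / (A * C))) = n5 * n6 * B * X"
    using nz by (simp add: D_def)
  ultimately show ?thesis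
    using arg_cong[OF eq, of "\<lambda>x. D * x"] unfolding distrib_left by simp
qed

text \<open>
  The relation compares two evaluations of a product of two Kronecker series: directly, and after
  splitting each term of the double sum by \<open>kronecker_product_split\<close>, which leaves products of single series.
\<close>

theorem theta_three_term:
  assumes p: "p \<noteq> 0"
    and a: "norm p < norm a" "norm a < 1"
    and b: "norm p < norm (c * d)" "norm (c * d) < 1"
    and ab: "norm p < norm (a * (c * d))" "norm (a * (c * d)) < 1"
    and y: "y \<noteq> 0" "\<And>n. y * p powi n \<noteq> 1"
    and c: "\<And>n. c * p powi n \<noteq> 1"
    and yc: "\<And>n. y * c * p powi n \<noteq> 1"
  shows "theta (a * (y * c)) p * theta (c * d * y) p * theta (a * (c * d)) p * theta c p =
         theta (a * (c * d) * y) p * theta (a * c) p * theta (c * d) p * theta (y * c) p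
         - c * theta (a * (c * d) * (y * c)) p * theta d p * theta a p * theta y p"
proof -
  \<comment> \<open>With \<open>b = c * d\<close> the series with parameters \<open>b\<close> and
    \<open>1 / c\<close> has theta at \<open>b / c = d\<close> in its numerator.\<close>
  define b where "b = c * d"
  note b = b[folded b_def] and ab = ab[folded b_def]
  have p1: "norm p < 1" using a by simp
  have nz: "a \<noteq> 0" "b \<noteq> 0" "c \<noteq> 0" "d \<noteq> 0"
    using a assms(4) by (auto simp: b_def)
  have ic: "1 / c * p powi n \<noteq> 1" for n
    using c[of "- n"] nz by (auto simp: power_int_minus field_simps)
  note F = kronecker[OF p]
  note N = kronecker_abs_summable[OF p]
  note kr = has_sum_times[OF F F N N]
  define J where "J = qpoch p p"
  define G where "G = (\<lambda>a z. J\<^sup>2 * theta (a * z) p / (theta a p * theta z p))"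
  have ycn: "y * c \<noteq> 0" and icn: "1 / c \<noteq> 0" using y nz by auto
  have "((\<lambda>(m, n). kronecker_term p a (y * c) m * kronecker_term p b y n) has_sum
          G a (y * c) * G b y) (UNIV \<times> UNIV)"
    using kr[OF a ycn yc b y a ycn yc b y] by (simp add: G_def J_def)
  moreover have "((\<lambda>(m, n). kronecker_term p a (y * c) m * kronecker_term p b y n) has_sum
          G (a * b) (y * c) * G b (1 / c) + G (a * b) y * G a c) (UNIV \<times> UNIV)"
  proof -
    have 1: "((\<lambda>(m, k). kronecker_term p (a * b) (y * c) m * kronecker_term p b (1 / c) k) has_sum
          G (a * b) (y * c) * G b (1 / c)) (UNIV \<times> UNIV)"
      using kr[OF ab ycn yc b icn ic ab ycn yc b icn ic] by (simp add: G_def J_def)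
    \<comment> \<open>Shearing the index lattice makes \<open>n - m\<close> an independent summation
      variable.\<close>
    have bij1: "bij_betw (\<lambda>(m, n). (m, n - m)) (UNIV \<times> UNIV) (UNIV \<times> (UNIV :: int set))"
      by (rule bij_betw_byWitness[of _ "\<lambda>(m, k). (m, k + m)"]) auto
    have 2: "((\<lambda>(n, k). kronecker_term p (a * b) y n * kronecker_term p a c k) has_sum
          G (a * b) y * G a c) (UNIV \<times> UNIV)"
      using kr[OF ab y a nz(3) c ab y a nz(3) c] by (simp add: G_def J_def)
    have bij2: "bij_betw (\<lambda>(m, n). (n, m - n)) (UNIV \<times> UNIV) (UNIV \<times> (UNIV :: int set))"
      by (rule bij_betw_byWitness[of _ "\<lambda>(n, k). (k + n, n)"]) auto
    note h = has_sum_add[OF iffD2[OF has_sum_reindex_bij_betw[OF bij1] 1]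
        iffD2[OF has_sum_reindex_bij_betw[OF bij2] 2]]
    show ?thesis
      by (rule iffD1[OF has_sum_cong h])
        (auto simp: kronecker_product_split[OF p nz(1,2) y(1) nz(3) c y(2) yc])
  qed
  ultimately have eq: "G a (y * c) * G b y = G (a * b) (y * c) * G b (1 / c) + G (a * b) y * G a c"
    by (rule has_sum_unique)
  have th1: "theta w p \<noteq> 0" if "norm p < norm w" "norm w < 1" for w
    by (rule theta_nonzero[OF p1 _ not_power_of_norm[OF that]]) (use that in auto)
  have th: "theta a p \<noteq> 0" "theta b p \<noteq> 0" "theta (a * b) p \<noteq> 0" "theta y p \<noteq> 0" "theta c p \<noteq> 0"
     "theta (y * c) p \<noteq> 0" "J\<^sup>2 \<noteq> 0"
    using th1[OF a] th1[OF b] th1[OF ab] theta_nonzero[OF p1 y] theta_nonzero[OF p1 nz(3) c]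
      theta_nonzero[OF p1 ycn yc] qpoch_self_nonzero[OF p1]
    by (simp_all add: J_def)
  have bc: "b * (1 / c) = d" using nz by (simp add: b_def)
  show ?thesis
    unfolding b_def[symmetric]
    by (rule three_term_algebra[OF th eq[unfolded G_def theta_inverse[OF p1 p nz(3)] bc]]) (rule nz(3))
qed

section \<open>Dissection of a theta quotient modulo m\<close>

text \<open>With \<open>Z = z * p powi n\<close>, the summand \<open>Z ^ j\<close> of (1 - Z^m)/(1 -
  Z) yields \<open>z ^ j\<close> times a Kronecker term with base \<open>p ^ m\<close> and
  \<open>a * p ^ j\<close> in place of \<open>a\<close>. Both sides then sum the same
  series.\<close>

theorem theta_quotient_dissection:
  assumes p: "p \<noteq> 0" and a: "norm p < norm a" "norm a < 1" and z: "z \<noteq> 0"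
    and zm: "\<And>n. z ^ m * (p ^ m) powi n \<noteq> 1"
  shows "(qpoch p p)\<^sup>2 * theta (a * z) p / (theta a p * theta z p) =
    (\<Sum>j<m. z ^ j * ((qpoch (p ^ m) (p ^ m))\<^sup>2 * theta (a * p ^ j * z ^ m) (p ^ m) /
                   (theta (a * p ^ j) (p ^ m) * theta (z ^ m) (p ^ m))))"
proof (rule has_sum_unique)
  have zm': "(z * p powi n) ^ m \<noteq> 1" for n
    using zm[of n] by (simp add: power_mult_distrib power_int_power mult.commute flip: power_int_power')
  then have z1: "z * p powi n \<noteq> 1" for n by (metis power_one)
  show "(kronecker_term p a z has_sum
      (qpoch p p)\<^sup>2 * theta (a * z) p / (theta a p * theta z p)) UNIV"
    by (rule kronecker[OF p a z z1])
  have "kronecker_term p a z n = (\<Sum>j<m. z ^ j * kronecker_term (p ^ m) (a * p ^ j) (z ^ m) n)" for n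
  proof -
    define Z where "Z = z * p powi n"
    have "(p ^ j) powi n = (p powi n) ^ j" for j
      by (metis power_int_mult power_int_of_nat mult.commute)
    then have "z ^ j * kronecker_term (p ^ m) (a * p ^ j) (z ^ m) n = a powi n * Z ^ j / (1 - Z ^ m)" for j
      by (simp add: kronecker_term_def Z_def power_int_mult_distrib power_mult_distrib)
    then have "(\<Sum>j<m. z ^ j * kronecker_term (p ^ m) (a * p ^ j) (z ^ m) n) =
        a powi n * (\<Sum>j<m. Z ^ j) / (1 - Z ^ m)"
      by (simp add: sum_distrib_left sum_divide_distrib)
    also have "\<dots> = a powi n / (1 - Z)"
      using zm'[of n] z1[of n] by (simp add: Z_def[symmetric] sum_gp_strict)
    finally show ?thesis by (simp add: kronecker_term_def Z_def)
  qed
  moreover have "((\<lambda>n. \<Sum>j<m. z ^ j * kronecker_term (p ^ m) (a * p ^ j) (z ^ m) n) has_sum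
    (\<Sum>j<m. z ^ j * ((qpoch (p ^ m) (p ^ m))\<^sup>2 * theta (a * p ^ j * z ^ m) (p ^ m) /
                   (theta (a * p ^ j) (p ^ m) * theta (z ^ m) (p ^ m))))) UNIV"
  proof (intro has_sum_finite_sum has_sum_cmult_right kronecker zm)
    \<comment> \<open>The bound \<open>j < m\<close> keeps \<open>a * p ^ j\<close> inside the
      annulus that belongs to \<open>p ^ m\<close>.\<close>
    fix j assume j: "j \<in> {..<m}"
    have np: "norm p < 1" "norm p > 0" using a p by auto
    have "norm (p ^ m) \<le> norm p * norm p ^ j"
      unfolding norm_power using j np power_decreasing[of "Suc j" m "norm p"] by simp
    also have "\<dots> < norm a * norm p ^ j"
      using a np by simp
    finally show "norm (p ^ m) < norm (a * p ^ j)"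
      by (simp add: norm_mult norm_power)
    have "norm a * norm p ^ j \<le> norm a * 1"
      using np by (intro mult_left_mono power_le_one) auto
    then show "norm (a * p ^ j) < 1"
      using a by (simp add: norm_mult norm_power)
  qed (use p z in auto)
  ultimately show "(kronecker_term p a z has_sum
    (\<Sum>j<m. z ^ j * ((qpoch (p ^ m) (p ^ m))\<^sup>2 * theta (a * p ^ j * z ^ m) (p ^ m) /
                   (theta (a * p ^ j) (p ^ m) * theta (z ^ m) (p ^ m))))) UNIV"
    by (simp cong: has_sum_cong)
qed

section \<open>Theta values at powers of Q with base Q^10\<close>

context
  fixes Q :: complex
  assumes Q: "Q \<noteq> 0" "norm Q < 1"
begin

text \<open>Indexing by the exponent reduces theta identities to arithmetic of indices. In the
  application \<open>Q = q ^ 5\<close>, so the base is \<open>q ^ 50\<close>.\<close>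

definition th10 :: "nat \<Rightarrow> complex" where
  "th10 i = theta (Q ^ i) (Q ^ 10)"

lemma norm_Q10: "norm (Q ^ 10) < 1" "Q ^ 10 \<noteq> 0"
  using Q by (simp_all add: norm_power power_less_one_iff)

lemma norm_Q_between:
  assumes "0 < i" "i < 10"
  shows "norm (Q ^ 10) < norm (Q ^ i)" "norm (Q ^ i) < 1"
  using assms Q power_strict_decreasing[of i 10 "norm Q"]
  by (simp_all add: norm_power power_less_one_iff)

lemma th10_shift: "th10 (10 + i) = - th10 i / Q ^ i"
  unfolding th10_def power_add using Q theta_shift[OF norm_Q10] by simp

lemma th10_reflect:
  assumes "i \<le> 10"
  shows "th10 (10 - i) = th10 i"
  unfolding th10_def using theta_reflect[OF norm_Q10(2), of "Q ^ i"] assms Q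
  by (simp add: power_diff)

lemma th10_nonzero:
  assumes "0 < i" "i < 10"
  shows "th10 i \<noteq> 0"
  unfolding th10_def
  by (intro theta_nonzero norm_Q10 not_power_of_norm norm_Q_between assms) (use Q in simp)

text \<open>At \<open>z = p\<close> the second product starts with \<open>1 - p / z = 0\<close>.
  This removes one of the five terms from the dissections with \<open>t = 1\<close> and
  \<open>t = 3\<close>.\<close>

lemma th10_10: "th10 10 = 0"
  using norm_Q10 qpoch_shift[OF norm_Q10(1), of 1] by (simp add: th10_def theta_def)

text \<open>The dissections involve indices up to 13; these values bring them back to 1, ...,
  5.\<close>

lemma th10_values:
  "th10 6 = th10 4" "th10 7 = th10 3" "th10 8 = th10 2" "th10 9 = th10 1"
  "th10 11 = - th10 1 / Q" "th10 12 = - th10 2 / Q ^ 2" "th10 13 = - th10 3 / Q ^ 3"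
  using th10_reflect[of 4] th10_reflect[of 3] th10_reflect[of 2] th10_reflect[of 1]
    th10_shift[of 1] th10_shift[of 2] th10_shift[of 3]
  by simp_all

text \<open>\<open>theta_three_term\<close> at powers of \<open>Q\<close>: the bounds on the indices
  are its annulus and non-vanishing conditions.\<close>

lemma th10_three_term:
  assumes "0 < i" "i + k + l < 10" "0 < k" "0 < j" "j + k < 10"
  shows "th10 (i + j + k) * th10 (k + l + j) * th10 (i + k + l) * th10 k =
    th10 (i + k + l + j) * th10 (i + k) * th10 (k + l) * th10 (j + k)
    - Q ^ k * th10 (i + k + l + j + k) * th10 l * th10 i * th10 j"
proof -
  have n: "Q ^ m * (Q ^ 10) powi n \<noteq> 1" if "0 < m" "m < 10" for m n
    by (intro not_power_of_norm norm_Q_between that)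
  have "theta (Q ^ i * (Q ^ j * Q ^ k)) (Q ^ 10) * theta (Q ^ k * Q ^ l * Q ^ j) (Q ^ 10) *
      theta (Q ^ i * (Q ^ k * Q ^ l)) (Q ^ 10) * theta (Q ^ k) (Q ^ 10) =
    theta (Q ^ i * (Q ^ k * Q ^ l) * Q ^ j) (Q ^ 10) * theta (Q ^ i * Q ^ k) (Q ^ 10) *
      theta (Q ^ k * Q ^ l) (Q ^ 10) * theta (Q ^ j * Q ^ k) (Q ^ 10)
    - Q ^ k * theta (Q ^ i * (Q ^ k * Q ^ l) * (Q ^ j * Q ^ k)) (Q ^ 10) * theta (Q ^ l) (Q ^ 10) *
      theta (Q ^ i) (Q ^ 10) * theta (Q ^ j) (Q ^ 10)"
    unfolding power_add[symmetric]
    using assms Q n norm_Q10 norm_Q_between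
    by (intro theta_three_term[where a = "Q ^ i" and c = "Q ^ k" and d = "Q ^ l" and y = "Q ^ j",
          unfolded power_add[symmetric]]) auto
  then show ?thesis
    by (simp add: th10_def power_add mult.assoc)
qed

lemma th10_relations:
  "th10 3 * (th10 3 ^ 2 * th10 5 - Q ^ 2 * th10 1 ^ 3) = th10 2 * th10 4 ^ 3"
  "th10 1 * th10 3 * (th10 5 ^ 2 + Q * th10 1 * th10 3) = th10 2 ^ 2 * th10 4 ^ 2"
  "th10 1 * (th10 3 ^ 3 + Q * th10 1 ^ 2 * th10 5) = th10 2 ^ 3 * th10 4"
  \<comment> \<open>The parameters are listed in the order \<open>i\<close>, \<open>k\<close>,
    \<open>l\<close>, \<open>j\<close>; each choice gives the relation in the same position.\<close>
  using th10_three_term[of 1 2 1 1] th10_three_term[of 1 1 1 3] th10_three_term[of 1 1 1 1]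
  by (simp_all add: th10_values power2_eq_square power3_eq_cube algebra_simps del: One_nat_def)

text \<open>Splitting the products with base \<open>Q ^ 2\<close> modulo 5 expresses everything by
  the products \<open>u i\<close> with base \<open>Q ^ 10\<close>, where the square of
  \<open>u 10\<close> cancels. This is the factor in front of each dissection.\<close>

lemma prefactor_eq:
  "(qpoch (Q ^ 10) (Q ^ 10))\<^sup>2 * theta Q (Q\<^sup>2) / (qpoch (Q\<^sup>2) (Q\<^sup>2))\<^sup>2 =
     th10 1 ^ 2 * th10 3 ^ 2 * th10 5 / (th10 2 ^ 2 * th10 4 ^ 2)"
proof -
  define u where "u = (\<lambda>i. qpoch (Q ^ i) (Q ^ 10))"
  have Q2: "norm (Q\<^sup>2) < 1" using Q by (simp add: norm_power power_less_one_iff)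
  have t: "th10 i = u i * u (10 - i)" if "i \<le> 10" for i
    using that Q by (simp add: th10_def theta_def u_def power_diff)
  have "qpoch Q (Q\<^sup>2) = u 1 * u 3 * u 5 * u 7 * u 9"
    unfolding qpoch_dissect[OF Q2, of 5 Q, simplified]
    by (simp add: u_def eval_nat_numeral mult_ac)
  moreover have "qpoch (Q\<^sup>2) (Q\<^sup>2) = u 2 * u 4 * u 6 * u 8 * u 10"
    unfolding qpoch_dissect[OF Q2, of 5 "Q\<^sup>2", simplified]
    by (simp add: u_def eval_nat_numeral mult_ac)
  moreover have "theta Q (Q\<^sup>2) = (qpoch Q (Q\<^sup>2))\<^sup>2"
    using Q by (simp add: theta_def power2_eq_square)
  moreover have "u 10 \<noteq> 0"
    unfolding u_def by (rule qpoch_self_nonzero[OF norm_Q10(1)])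
  moreover have "qpoch (Q ^ 10) (Q ^ 10) = u 10"
    by (simp add: u_def)
  ultimately show ?thesis
    by (simp add: t power_mult_distrib power2_eq_square mult_ac)
qed

end

text \<open>
  \<open>x\<^sub>i\<close> stands for \<open>[q^(5i); q^50]\<close>. The product of the two numerators is arranged by the exponent of
  \<open>q\<close> modulo 5; the remaining powers of \<open>q^5\<close> are absorbed into the left-hand sides of the relations.
\<close>

lemma dissection_algebra:
  fixes q x1 x2 x3 x4 x5 :: complex
  assumes nz: "x1 \<noteq> 0" "x2 \<noteq> 0" "x3 \<noteq> 0" "x4 \<noteq> 0" "x5 \<noteq> 0"
    and R1: "x3 * (x3 ^ 2 * x5 - q ^ 10 * x1 ^ 3) = x2 * x4 ^ 3"
    and R2: "x1 * x3 * (x5 ^ 2 + q ^ 5 * x1 * x3) = x2 ^ 2 * x4 ^ 2"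
  shows "(x1 ^ 2 * x3 ^ 2 * x5 / (x2 ^ 2 * x4 ^ 2)) ^ 2 *
     ((x4 / (x1 * x3) + q ^ 3 * (x4 / (x3 * x3)) + q ^ 6 * (x2 / (x5 * x3)) - q ^ 2 * (x2 / (x1 * x3))) *
      (x5 / (x1 * x4) + q ^ 4 * (1 / x4) + q ^ 8 * (x1 / (x5 * x4)) - q ^ 7 * (x1 / (x3 * x4))
        - q * (x3 / (x1 * x4)))) =
     x1 ^ 2 * x5 ^ 2 / (x2 ^ 3 * x4) - q * (x1 ^ 2 * x3 * x5 / (x2 ^ 3 * x4))
     - q ^ 2 * (x1 * x3 ^ 2 * x5 / (x2 * x4 ^ 3)) + 2 * q ^ 3 * (x1 ^ 2 * x3 * x5 / (x2 ^ 2 * x4 ^ 2))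
     + q ^ 9 * (x1 ^ 3 * x3 / (x2 * x4 ^ 3))"
proof -
  define E1 where "E1 = x3 ^ 2 * x5 - q ^ 10 * x1 ^ 3"
  define E2 where "E2 = x5 ^ 2 + q ^ 5 * x1 * x3"
  have E1: "E1 = x2 * x4 ^ 3 / x3"
    using R1 nz by (simp add: E1_def field_simps)
  have E2: "E2 = x2 ^ 2 * x4 ^ 2 / (x1 * x3)"
    using R2 nz by (simp add: E2_def field_simps)
  have G3: "x4 / (x1 * x3) + q ^ 3 * (x4 / (x3 * x3)) + q ^ 6 * (x2 / (x5 * x3)) - q ^ 2 * (x2 / (x1 * x3)) =
     (x3 * x4 * x5 + q ^ 3 * x1 * x4 * x5 + q ^ 6 * x1 * x2 * x3 - q ^ 2 * x2 * x3 * x5) / (x1 * x3 ^ 2 * x5)"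
    using nz by (simp add: add_divide_distrib diff_divide_distrib power2_eq_square mult_ac)
  have G4: "x5 / (x1 * x4) + q ^ 4 * (1 / x4) + q ^ 8 * (x1 / (x5 * x4)) - q ^ 7 * (x1 / (x3 * x4))
        - q * (x3 / (x1 * x4)) =
     (x3 * x5 ^ 2 + q ^ 4 * x1 * x3 * x5 + q ^ 8 * x1 ^ 2 * x3 - q ^ 7 * x1 ^ 2 * x5 - q * x3 ^ 2 * x5) /
     (x1 * x3 * x4 * x5)"
    using nz by (simp add: add_divide_distrib diff_divide_distrib power2_eq_square mult_ac)
  \<comment> \<open>\<open>E1\<close> and \<open>E2\<close> involve only powers of
    \<open>q ^ 5\<close>, so the five summands belong to different residues. The two parts at
    \<open>q ^ 3\<close> become equal once \<open>E1\<close> and \<open>E2\<close> are replaced,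
    whence the coefficient 2.\<close>
  have N: "(x3 * x4 * x5 + q ^ 3 * x1 * x4 * x5 + q ^ 6 * x1 * x2 * x3 - q ^ 2 * x2 * x3 * x5) *
     (x3 * x5 ^ 2 + q ^ 4 * x1 * x3 * x5 + q ^ 8 * x1 ^ 2 * x3 - q ^ 7 * x1 ^ 2 * x5 - q * x3 ^ 2 * x5) =
     E1 * x4 * x5 ^ 2 - q * E1 * x3 * x4 * x5 - q ^ 2 * x2 * x3 ^ 2 * x5 * E2
     + q ^ 3 * (x1 * x3 * x4 * x5 * E2 + x2 * x3 * x5 * E1) + q ^ 9 * x1 ^ 2 * x2 * x3 * E2"
    unfolding E1_def E2_def by algebra
  show ?thesis
    unfolding G3 G4 times_divide_times_eq N E1 E2
    using nz by (simp add: add_divide_distrib diff_divide_distrib distrib_left right_diff_distrib)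
      (simp add: field_simps eval_nat_numeral)
qed

text \<open>The same arrangement by residues modulo 5, with \<open>R3\<close> taking the place of
  \<open>R1\<close>; here the doubled residue class is that of \<open>q ^ 2\<close>.\<close>

lemma reciprocal_dissection_algebra:
  fixes q x1 x2 x3 x4 x5 :: complex
  assumes nz: "x1 \<noteq> 0" "x2 \<noteq> 0" "x3 \<noteq> 0" "x4 \<noteq> 0" "x5 \<noteq> 0"
    and R2: "x1 * x3 * (x5 ^ 2 + q ^ 5 * x1 * x3) = x2 ^ 2 * x4 ^ 2"
    and R3: "x1 * (x3 ^ 3 + q ^ 5 * x1 ^ 2 * x5) = x2 ^ 3 * x4"
  shows "(x1 ^ 2 * x3 ^ 2 * x5 / (x2 ^ 2 * x4 ^ 2)) ^ 2 *
     ((x2 / (x1 * x1) + q * (x4 / (x3 * x1)) + q ^ 2 * (x4 / (x5 * x1)) + q ^ 3 * (x2 / (x3 * x1))) *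
      (x3 / (x1 * x2) + q ^ 2 * (x5 / (x3 * x2)) + q ^ 4 * (x3 / (x5 * x2)) + q ^ 6 * (x1 / (x3 * x2))
        - q ^ 3 * (1 / x2))) =
     x3 ^ 2 * x5 ^ 2 / (x2 * x4 ^ 3) + q * (x1 * x3 ^ 3 / (x2 ^ 3 * x4))
     + 2 * q ^ 2 * (x1 * x3 ^ 2 * x5 / (x2 ^ 2 * x4 ^ 2)) + q ^ 3 * (x1 ^ 2 * x3 * x5 / (x2 ^ 3 * x4))
     + q ^ 4 * (x1 * x3 ^ 2 * x5 / (x2 * x4 ^ 3))"
proof -
  define E2 where "E2 = x5 ^ 2 + q ^ 5 * x1 * x3"
  define E3 where "E3 = x3 ^ 3 + q ^ 5 * x1 ^ 2 * x5"
  have E2: "E2 = x2 ^ 2 * x4 ^ 2 / (x1 * x3)"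
    using R2 nz by (simp add: E2_def field_simps)
  have E3: "E3 = x2 ^ 3 * x4 / x1"
    using R3 nz by (simp add: E3_def field_simps)
  have G1: "x2 / (x1 * x1) + q * (x4 / (x3 * x1)) + q ^ 2 * (x4 / (x5 * x1)) + q ^ 3 * (x2 / (x3 * x1)) =
     (x2 * x3 * x5 + q * x1 * x4 * x5 + q ^ 2 * x1 * x3 * x4 + q ^ 3 * x1 * x2 * x5) / (x1 ^ 2 * x3 * x5)"
    using nz by (simp add: add_divide_distrib diff_divide_distrib power2_eq_square mult_ac)
  have G2: "x3 / (x1 * x2) + q ^ 2 * (x5 / (x3 * x2)) + q ^ 4 * (x3 / (x5 * x2)) + q ^ 6 * (x1 / (x3 * x2))
        - q ^ 3 * (1 / x2) =
     (x3 ^ 2 * x5 + q ^ 2 * x1 * x5 ^ 2 + q ^ 4 * x1 * x3 ^ 2 + q ^ 6 * x1 ^ 2 * x5 - q ^ 3 * x1 * x3 * x5) /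
     (x1 * x2 * x3 * x5)"
    using nz by (simp add: add_divide_distrib diff_divide_distrib power2_eq_square mult_ac)
  have N: "(x2 * x3 * x5 + q * x1 * x4 * x5 + q ^ 2 * x1 * x3 * x4 + q ^ 3 * x1 * x2 * x5) *
     (x3 ^ 2 * x5 + q ^ 2 * x1 * x5 ^ 2 + q ^ 4 * x1 * x3 ^ 2 + q ^ 6 * x1 ^ 2 * x5 - q ^ 3 * x1 * x3 * x5) =
     E3 * x2 * x5 ^ 2 + q * x1 * x3 ^ 2 * x4 * E2 + q ^ 2 * (x1 * x2 * x3 * x5 * E2 + x1 * x4 * x5 * E3)
     + q ^ 3 * x1 ^ 2 * x4 * x5 * E2 + q ^ 4 * x1 * x2 * x5 * E3"
    unfolding E2_def E3_def by algebra
  show ?thesis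
    unfolding G1 G2 times_divide_times_eq N E2 E3
    using nz by (simp add: add_divide_distrib diff_divide_distrib distrib_left right_diff_distrib)
      (simp add: field_simps eval_nat_numeral)
qed

section \<open>From base q^10 to base q^50, and the two expansions\<close>

text \<open>\<open>theta_quotient_dissection\<close> for \<open>m = 5\<close>,
  \<open>p = Q ^ 2\<close>, \<open>a = Q\<close>, \<open>z = q ^ t\<close>. Then
  \<open>z ^ 5 = Q ^ t\<close> and \<open>a * p ^ j = Q ^ (1 + 2 * j)\<close>, so only theta values
  \<open>th10\<close> occur on the right.\<close>

lemma theta_quotient_level_10:
  fixes q :: complex
  assumes q: "q \<noteq> 0" "norm q < 1" and t: "0 < t" "t < 5"
  shows "theta (q ^ (5 + t)) (q ^ 10) / theta (q ^ t) (q ^ 10) =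
    th10 (q ^ 5) 1 ^ 2 * th10 (q ^ 5) 3 ^ 2 * th10 (q ^ 5) 5 / (th10 (q ^ 5) 2 ^ 2 * th10 (q ^ 5) 4 ^ 2) *
    (\<Sum>j<5. q ^ (t * j) * (th10 (q ^ 5) (1 + 2 * j + t) / (th10 (q ^ 5) (1 + 2 * j) * th10 (q ^ 5) t)))"
proof -
  define Q where "Q = q ^ 5"
  have Q: "Q \<noteq> 0" "norm Q < 1"
    using q by (simp_all add: Q_def norm_power power_less_one_iff)
  have p: "q ^ 10 = Q\<^sup>2" by (simp add: Q_def flip: power_mult)
  have pn: "norm (Q\<^sup>2) < norm Q" "norm (Q\<^sup>2) < 1"
    using Q by (simp add: power2_eq_square norm_mult) (use Q in \<open>simp add: norm_power power_less_one_iff\<close>)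
  have z5: "(q ^ t) ^ 5 = Q ^ t" by (simp add: Q_def mult.commute flip: power_mult)
  have Q2: "(Q\<^sup>2) ^ n = Q ^ (2 * n)" for n by (simp flip: power_mult)
  have "(qpoch (Q\<^sup>2) (Q\<^sup>2))\<^sup>2 * theta (Q * q ^ t) (Q\<^sup>2) / (theta Q (Q\<^sup>2) * theta (q ^ t) (Q\<^sup>2)) =
    (\<Sum>j<5. (q ^ t) ^ j * ((qpoch ((Q\<^sup>2) ^ 5) ((Q\<^sup>2) ^ 5))\<^sup>2 * theta (Q * (Q\<^sup>2) ^ j * (q ^ t) ^ 5) ((Q\<^sup>2) ^ 5) /
                   (theta (Q * (Q\<^sup>2) ^ j) ((Q\<^sup>2) ^ 5) * theta ((q ^ t) ^ 5) ((Q\<^sup>2) ^ 5))))"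
  proof (rule theta_quotient_dissection)
    show "(q ^ t) ^ 5 * ((Q\<^sup>2) ^ 5) powi n \<noteq> 1" for n
      unfolding z5 Q2 using not_power_of_norm[OF norm_Q_between[OF Q, of t]] t by simp
  qed (use Q q pn in auto)
  also have "\<dots> = (\<Sum>j<5. (qpoch (Q ^ 10) (Q ^ 10))\<^sup>2 *
      (q ^ (t * j) * (th10 Q (1 + 2 * j + t) / (th10 Q (1 + 2 * j) * th10 Q t))))"
    unfolding z5 Q2 unfolding power_mult[of q t, symmetric]
    by (intro sum.cong) (simp_all add: th10_def[OF Q] power_add mult_ac)
  also have "\<dots> = (qpoch (Q ^ 10) (Q ^ 10))\<^sup>2 *
      (\<Sum>j<5. q ^ (t * j) * (th10 Q (1 + 2 * j + t) / (th10 Q (1 + 2 * j) * th10 Q t)))"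
    by (rule sum_distrib_left[symmetric])
  finally have eq: "(qpoch (Q\<^sup>2) (Q\<^sup>2))\<^sup>2 * theta (Q * q ^ t) (Q\<^sup>2) / (theta Q (Q\<^sup>2) * theta (q ^ t) (Q\<^sup>2)) =
      (qpoch (Q ^ 10) (Q ^ 10))\<^sup>2 *
      (\<Sum>j<5. q ^ (t * j) * (th10 Q (1 + 2 * j + t) / (th10 Q (1 + 2 * j) * th10 Q t)))" .
  have J: "qpoch (Q\<^sup>2) (Q\<^sup>2) \<noteq> 0" by (rule qpoch_self_nonzero[OF pn(2)])
  have th: "theta Q (Q\<^sup>2) \<noteq> 0"
    using Q pn by (intro theta_nonzero not_power_of_norm) auto
  \<comment> \<open>The theta quotient is isolated; the factor moved to the other side is the one
    evaluated by \<open>prefactor_eq\<close>.\<close>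
  have "theta (Q * q ^ t) (Q\<^sup>2) / theta (q ^ t) (Q\<^sup>2) =
     ((qpoch (Q\<^sup>2) (Q\<^sup>2))\<^sup>2 * theta (Q * q ^ t) (Q\<^sup>2) / (theta Q (Q\<^sup>2) * theta (q ^ t) (Q\<^sup>2))) *
     (theta Q (Q\<^sup>2) / (qpoch (Q\<^sup>2) (Q\<^sup>2))\<^sup>2)"
    using J th by simp
  also have "\<dots> = ((qpoch (Q ^ 10) (Q ^ 10))\<^sup>2 * theta Q (Q\<^sup>2) / (qpoch (Q\<^sup>2) (Q\<^sup>2))\<^sup>2) *
      (\<Sum>j<5. q ^ (t * j) * (th10 Q (1 + 2 * j + t) / (th10 Q (1 + 2 * j) * th10 Q t)))"
    unfolding eq by simp
  finally show ?thesis
    unfolding prefactor_eq[OF Q] p power_add Q_def[symmetric] .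
qed

theorem theorem1p1:
  fixes q :: complex
  assumes "norm q < 1"
  shows "RR q * RR (q ^ 2) ^ 2 =
        (qpochs [q ^ 5, q ^ 5, q ^ 25, q ^ 25, q ^ 25, q ^ 25, q ^ 45, q ^ 45] (q ^ 50)
          / qpochs [q ^ 10, q ^ 10, q ^ 10, q ^ 20, q ^ 30, q ^ 40, q ^ 40, q ^ 40] (q ^ 50))
      - q * (qpochs [q ^ 5, q ^ 5, q ^ 15, q ^ 25, q ^ 25, q ^ 35, q ^ 45, q ^ 45] (q ^ 50)
          / qpochs [q ^ 10, q ^ 10, q ^ 10, q ^ 20, q ^ 30, q ^ 40, q ^ 40, q ^ 40] (q ^ 50))
      - q ^ 2 * (qpochs [q ^ 5, q ^ 15, q ^ 15, q ^ 25, q ^ 25, q ^ 35, q ^ 35, q ^ 45] (q ^ 50)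
          / qpochs [q ^ 10, q ^ 20, q ^ 20, q ^ 20, q ^ 30, q ^ 30, q ^ 30, q ^ 40] (q ^ 50))
      + 2 * q ^ 3 * (qpochs [q ^ 5, q ^ 5, q ^ 15, q ^ 25, q ^ 25, q ^ 35, q ^ 45, q ^ 45] (q ^ 50)
          / qpochs [q ^ 10, q ^ 10, q ^ 20, q ^ 20, q ^ 30, q ^ 30, q ^ 40, q ^ 40] (q ^ 50))
      + q ^ 9 * (qpochs [q ^ 5, q ^ 5, q ^ 5, q ^ 15, q ^ 35, q ^ 45, q ^ 45, q ^ 45] (q ^ 50)
          / qpochs [q ^ 10, q ^ 20, q ^ 20, q ^ 20, q ^ 30, q ^ 30, q ^ 30, q ^ 40] (q ^ 50))
    \<and> 1 / (RR q * RR (q ^ 2) ^ 2) =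
        (qpochs [q ^ 15, q ^ 15, q ^ 25, q ^ 25, q ^ 25, q ^ 25, q ^ 35, q ^ 35] (q ^ 50)
          / qpochs [q ^ 10, q ^ 20, q ^ 20, q ^ 20, q ^ 30, q ^ 30, q ^ 30, q ^ 40] (q ^ 50))
      + q * (qpochs [q ^ 5, q ^ 15, q ^ 15, q ^ 15, q ^ 35, q ^ 35, q ^ 35, q ^ 45] (q ^ 50)
          / qpochs [q ^ 10, q ^ 10, q ^ 10, q ^ 20, q ^ 30, q ^ 40, q ^ 40, q ^ 40] (q ^ 50))
      + 2 * q ^ 2 * (qpochs [q ^ 5, q ^ 15, q ^ 15, q ^ 25, q ^ 25, q ^ 35, q ^ 35, q ^ 45] (q ^ 50)
          / qpochs [q ^ 10, q ^ 10, q ^ 20, q ^ 20, q ^ 30, q ^ 30, q ^ 40, q ^ 40] (q ^ 50))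
      + q ^ 3 * (qpochs [q ^ 5, q ^ 5, q ^ 15, q ^ 25, q ^ 25, q ^ 35, q ^ 45, q ^ 45] (q ^ 50)
          / qpochs [q ^ 10, q ^ 10, q ^ 10, q ^ 20, q ^ 30, q ^ 40, q ^ 40, q ^ 40] (q ^ 50))
      + q ^ 4 * (qpochs [q ^ 5, q ^ 15, q ^ 15, q ^ 25, q ^ 25, q ^ 35, q ^ 35, q ^ 45] (q ^ 50)
          / qpochs [q ^ 10, q ^ 20, q ^ 20, q ^ 20, q ^ 30, q ^ 30, q ^ 30, q ^ 40] (q ^ 50))"
proof (cases "q = 0")
  \<comment> \<open>Here all infinite products are 1 and only the leading terms survive. The theta
    functions need \<open>q \<noteq> 0\<close>, because they divide by their argument.\<close>
  case True
  then show ?thesis by (simp add: RR_def qpochs_def qpoch_def)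
next
  case False
  define Q where "Q = q ^ 5"
  have Q: "Q \<noteq> 0" "norm Q < 1"
    using False assms by (simp_all add: Q_def norm_power power_less_one_iff)
  have q10: "norm (q ^ 10) < 1" "q ^ 10 \<noteq> 0"
    using False assms by (simp_all add: norm_power power_less_one_iff)
  define P where "P = (\<lambda>i. theta (q ^ i) (q ^ 10))"
  define x where "x = th10 Q"
  have P_eq: "P i = qpoch (q ^ i) (q ^ 10) * qpoch (q ^ (10 - i)) (q ^ 10)" if "i \<le> 10" for i
    using that False by (simp add: P_def theta_def power_diff)
  have split: "qpoch A (q ^ 5) = qpoch A (q ^ 10) * qpoch (A * q ^ 5) (q ^ 10)" for A
  proof -
    have "qpoch A (q ^ 5) = (\<Prod>r<2. qpoch (A * (q ^ 5) ^ r) ((q ^ 5) ^ 2))"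
      using Q by (intro qpoch_dissect) (simp_all add: Q_def)
    also have "\<dots> = qpoch A ((q ^ 5) ^ 2) * qpoch (A * q ^ 5) ((q ^ 5) ^ 2)"
      by (simp add: lessThan_Suc numeral_2_eq_2 mult.commute)
    finally show ?thesis by (simp flip: power_mult)
  qed
  have RR1: "RR q = P 1 * P 4 / (P 2 * P 3)"
    unfolding RR_def qpochs_def
    by (simp add: split P_eq mult_ac flip: power_Suc power_add)
  have RR2: "RR (q ^ 2) = P 2 / P 4"
    unfolding RR_def qpochs_def by (simp add: P_eq flip: power_mult)
  have P_nonzero: "P i \<noteq> 0" if "0 < i" "i < 10" for i
    unfolding P_def
    by (intro theta_nonzero q10 not_power_of_norm norm_Q_between assms that) (use False assms in auto)
  have P_reflect: "P 6 = P 4" "P 7 = P 3" "P 8 = P 2" "P 9 = P 1"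
    by (simp_all add: P_eq)
  \<comment> \<open>The quotient is \<open>P 1 * P 2 / (P 3 * P 4)\<close>. Reflection raises the
    numerator indices so that each exceeds a denominator index by 5, as \<open>dis\<close> requires;
    the reciprocal uses \<open>t = 1\<close> and \<open>t = 2\<close>.\<close>
  have f: "RR q * RR (q ^ 2) ^ 2 = (P 8 / P 3) * (P 9 / P 4)"
    using P_nonzero[of 2] P_nonzero[of 4] unfolding RR1 RR2 P_reflect
    by (simp add: power2_eq_square)
  then have g: "1 / (RR q * RR (q ^ 2) ^ 2) = (P 6 / P 1) * (P 7 / P 2)"
    unfolding P_reflect by (simp add: mult.commute)
  have x_eq: "x i = qpoch (q ^ (5 * i)) (q ^ 50) * qpoch (q ^ (50 - 5 * i)) (q ^ 50)" if "i \<le> 10" for i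
    unfolding x_def th10_def[OF Q] using that False
    by (simp add: theta_def Q_def power_diff flip: power_mult)
  define K where "K = x 1 ^ 2 * x 3 ^ 2 * x 5 / (x 2 ^ 2 * x 4 ^ 2)"
  have dis: "P (5 + t) / P t = K * (\<Sum>j<5. q ^ (t * j) * (x (1 + 2 * j + t) / (x (1 + 2 * j) * x t)))"
    if "0 < t" "t < 5" for t
    using theta_quotient_level_10[OF False assms that] by (simp add: P_def K_def x_def Q_def)
  have xnz: "x 1 \<noteq> 0" "x 2 \<noteq> 0" "x 3 \<noteq> 0" "x 4 \<noteq> 0" "x 5 \<noteq> 0"
    unfolding x_def by (simp_all add: th10_nonzero[OF Q])
  have xv: "x 6 = x 4" "x 7 = x 3" "x 8 = x 2" "x 9 = x 1" "x 10 = 0"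
    "x 11 = - x 1 / q ^ 5" "x 12 = - x 2 / q ^ 10" "x 13 = - x 3 / q ^ 15"
    unfolding x_def using th10_values[OF Q] th10_10[OF Q] by (simp_all add: Q_def flip: power_mult)
  have rel: "x 3 * (x 3 ^ 2 * x 5 - q ^ 10 * x 1 ^ 3) = x 2 * x 4 ^ 3"
    "x 1 * x 3 * (x 5 ^ 2 + q ^ 5 * x 1 * x 3) = x 2 ^ 2 * x 4 ^ 2"
    "x 1 * (x 3 ^ 3 + q ^ 5 * x 1 ^ 2 * x 5) = x 2 ^ 3 * x 4"
    using th10_relations[OF Q] by (simp_all add: x_def Q_def flip: power_mult)
  have five: "(\<Sum>j<5. h j) = h 0 + h 1 + h 2 + h 3 + h 4" for h :: "nat \<Rightarrow> complex"
    by (simp add: eval_nat_numeral)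
  \<comment> \<open>The values \<open>x 11\<close>, \<open>x 12\<close>, \<open>x 13\<close> bring
    negative powers of \<open>q\<close>, which combine with \<open>q ^ (t * j)\<close> to positive
    exponents.\<close>
  have cancel: "q ^ n * a / (q ^ m * b) = q ^ (n - m) * a / b" if "m \<le> n" for a b m n
    unfolding power_diff[OF False that] by simp
  have P83: "P 8 / P 3 = K * (x 4 / (x 1 * x 3) + q ^ 3 * (x 4 / (x 3 * x 3))
      + q ^ 6 * (x 2 / (x 5 * x 3)) - q ^ 2 * (x 2 / (x 1 * x 3)))"
    using dis[of 3] unfolding five by (simp add: xv cancel[of 10 12] del: One_nat_def)
  have P94: "P 9 / P 4 = K * (x 5 / (x 1 * x 4) + q ^ 4 * (1 / x 4) + q ^ 8 * (x 1 / (x 5 * x 4))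
      - q ^ 7 * (x 1 / (x 3 * x 4)) - q * (x 3 / (x 1 * x 4)))"
    using dis[of 4] xnz unfolding five
    by (simp add: xv cancel[of 5 12] cancel[of 15 16] del: One_nat_def)
  have P61: "P 6 / P 1 = K * (x 2 / (x 1 * x 1) + q * (x 4 / (x 3 * x 1)) + q ^ 2 * (x 4 / (x 5 * x 1))
      + q ^ 3 * (x 2 / (x 3 * x 1)))"
    using dis[of 1] unfolding five by (simp add: xv del: One_nat_def)
  have P72: "P 7 / P 2 = K * (x 3 / (x 1 * x 2) + q ^ 2 * (x 5 / (x 3 * x 2)) + q ^ 4 * (x 3 / (x 5 * x 2))
      + q ^ 6 * (x 1 / (x 3 * x 2)) - q ^ 3 * (1 / x 2))"
    using dis[of 2] xnz cancel[of 5 8 1 "x 2"] unfolding five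
    by (simp add: xv del: One_nat_def)
  have KK: "K * g1 * (K * g2) = K ^ 2 * (g1 * g2)" for g1 g2
    by (simp add: power2_eq_square)
  \<comment> \<open>An entry \<open>q ^ (5 * i)\<close> pairs with \<open>q ^ (50 - 5 * i)\<close>
    to give \<open>x i\<close>; for \<open>x 5\<close> two entries \<open>q ^ 25\<close> are
    paired.\<close>
  have nums:
    "qpochs [q ^ 5, q ^ 5, q ^ 25, q ^ 25, q ^ 25, q ^ 25, q ^ 45, q ^ 45] (q ^ 50) = x 1 ^ 2 * x 5 ^ 2"
    "qpochs [q ^ 5, q ^ 5, q ^ 15, q ^ 25, q ^ 25, q ^ 35, q ^ 45, q ^ 45] (q ^ 50) = x 1 ^ 2 * x 3 * x 5"
    "qpochs [q ^ 5, q ^ 15, q ^ 15, q ^ 25, q ^ 25, q ^ 35, q ^ 35, q ^ 45] (q ^ 50) = x 1 * x 3 ^ 2 * x 5"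
    "qpochs [q ^ 5, q ^ 5, q ^ 5, q ^ 15, q ^ 35, q ^ 45, q ^ 45, q ^ 45] (q ^ 50) = x 1 ^ 3 * x 3"
    "qpochs [q ^ 15, q ^ 15, q ^ 25, q ^ 25, q ^ 25, q ^ 25, q ^ 35, q ^ 35] (q ^ 50) = x 3 ^ 2 * x 5 ^ 2"
    "qpochs [q ^ 5, q ^ 15, q ^ 15, q ^ 15, q ^ 35, q ^ 35, q ^ 35, q ^ 45] (q ^ 50) = x 1 * x 3 ^ 3"
    by (simp_all add: qpochs_def x_eq power2_eq_square power3_eq_cube mult_ac)
  have dens:
    "qpochs [q ^ 10, q ^ 10, q ^ 10, q ^ 20, q ^ 30, q ^ 40, q ^ 40, q ^ 40] (q ^ 50) = x 2 ^ 3 * x 4"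
    "qpochs [q ^ 10, q ^ 20, q ^ 20, q ^ 20, q ^ 30, q ^ 30, q ^ 30, q ^ 40] (q ^ 50) = x 2 * x 4 ^ 3"
    "qpochs [q ^ 10, q ^ 10, q ^ 20, q ^ 20, q ^ 30, q ^ 30, q ^ 40, q ^ 40] (q ^ 50) = x 2 ^ 2 * x 4 ^ 2"
    by (simp_all add: qpochs_def x_eq power2_eq_square power3_eq_cube mult_ac)
  show ?thesis
    unfolding g unfolding f nums dens P83 P94 P61 P72 KK unfolding K_def
    by (intro conjI dissection_algebra reciprocal_dissection_algebra xnz rel)
qed

end
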